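(* Let $f\in\mathrm{Sym}^3\mathbb{C}^d$ be a homogeneous cubic polynomial in $d$ variables. The following conditions are equivalent. (a) There exists a nonzero homogeneous linear polynomial $\ell$ such that $\mathrm{Hess}(f)=\ell^{d}$. (b) $f$ is persistent.
   Context: Symmetric tensors in $\mathrm{Sym}^n\mathbb{C}^d$ are identified with homogeneous polynomials of degree $n$ in $\mathbb{C}[x_0,\ldots,x_{d-1}]$. The Hessian is $\mathrm{Hess}(f)=\det\left(\frac{\partial^2 f}{\partial x_i\partial x_j}\right)_{0\le i,j\le d-1}$. A homogeneous polynomial $f$ is concise if its partial derivatives $\partial f/\partial x_0,\ldots,\partial f/\partial x_{d-1}$ are linearly independent. For $u\in(\mathbb{C}^d)^\vee$ with coordinates $(u_0,\ldots,u_{d-1})$ write $\frac{\partial f}{\partial u}=\sum_i u_i\frac{\partial f}{\partial x_i}$. Persistence is defined recursively, with $V=\mathbb{C}^d$ fixed: (i) $f\in\mathrm{Sym}^2V$ is persistent if it is a quadratic form of maximal rank (nonsingular); (ii) for $n>2$, $f\in\mathrm{Sym}^nV$ is persistent if it is concise and there exists a hyperplane (linear subspace of codimension one) $S\subsetneq V^\vee$ such that $\frac{\partial f}{\partial u}\in\mathrm{Sym}^{n-1}V$ is persistent for every $u\notin S$. *)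

theory Defs
  imports "HOL-Analysis.Analysis" "HOL-Library.Poly_Mapping"
begin

text \<open>
  Polynomials over the complex numbers in finitely many variables, indexed by the finite type
  \<open>'n\<close>, so that \<open>d = CARD('n)\<close> (in particular \<open>d \<ge> 1\<close>). A polynomial maps exponent vectors to
  coefficients; multiplication is the convolution product of \<open>Poly_Mapping\<close>.
\<close>

type_synonym 'n cpoly = "('n \<Rightarrow>\<^sub>0 nat) \<Rightarrow>\<^sub>0 complex"

definition Const :: "complex \<Rightarrow> 'n cpoly" where
  "Const c = Poly_Mapping.single 0 c"

text \<open>The zero polynomial is homogeneous of every degree, so this describes the vector space
  \<open>Sym\<^sup>n V\<close>.\<close>

definition homogeneous :: "nat \<Rightarrow> 'n::finite cpoly \<Rightarrow> bool" where
  "homogeneous n f \<longleftrightarrow>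
     (\<forall>m \<in> Poly_Mapping.keys f. (\<Sum>i\<in>UNIV. Poly_Mapping.lookup m i) = n)"

text \<open>Subtraction of exponent vectors is truncated, but whenever truncation occurs the factor
  \<open>lookup m i\<close> is zero.\<close>

definition partial :: "'n \<Rightarrow> 'n cpoly \<Rightarrow> 'n cpoly" where
  "partial i f = (\<Sum>m\<in>Poly_Mapping.keys f.
     Poly_Mapping.single (m - Poly_Mapping.single i 1)
       (of_nat (Poly_Mapping.lookup m i) * Poly_Mapping.lookup f m))"

text \<open>Elements of the dual of \<open>V\<close> are given by their coordinates.\<close>

definition dir_partial :: "complex ^ 'n \<Rightarrow> 'n::finite cpoly \<Rightarrow> 'n cpoly" where
  "dir_partial u f = (\<Sum>i\<in>UNIV. Const (u $ i) * partial i f)"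

definition Hess :: "'n::finite cpoly \<Rightarrow> 'n cpoly" where
  "Hess f = det (\<chi> i j. partial i (partial j f))"

text \<open>Linear independence of the family of partial derivatives. It is stated for the family and
  not for the set of its members, since a repeated derivative is a dependency.\<close>

definition concise :: "'n::finite cpoly \<Rightarrow> bool" where
  "concise f \<longleftrightarrow>
     (\<forall>c :: 'n \<Rightarrow> complex. (\<Sum>i\<in>UNIV. Const (c i) * partial i f) = 0 \<longrightarrow> (\<forall>i. c i = 0))"

text \<open>The symmetric matrix \<open>A\<close> with \<open>q = (\<Sum>i j. A\<^sub>i\<^sub>j x\<^sub>i x\<^sub>j)\<close> for a quadratic form \<open>q\<close>: an
  off-diagonal coefficient of \<open>q\<close> is shared between two entries.\<close>

definition gram_matrix :: "'n::finite cpoly \<Rightarrow> complex ^ 'n ^ 'n" where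
  "gram_matrix q = (\<chi> i j.
     Poly_Mapping.lookup q (Poly_Mapping.single i 1 + Poly_Mapping.single j 1) /
       (if i = j then 1 else 2))"

definition hyperplane :: "(complex ^ 'n) set \<Rightarrow> bool" where
  "hyperplane S \<longleftrightarrow> vec.subspace S \<and> vec.dim S + 1 = CARD('n)"

text \<open>\<open>persistent n f\<close> says that \<open>f\<close> is a persistent element of \<open>Sym\<^sup>n V\<close>. Persistence is only
  defined for \<open>n \<ge> 2\<close>; the first two equations are dummies.\<close>

fun persistent :: "nat \<Rightarrow> 'n::finite cpoly \<Rightarrow> bool" where
  "persistent 0 f \<longleftrightarrow> False"
| "persistent (Suc 0) f \<longleftrightarrow> False"
| "persistent (Suc (Suc 0)) f \<longleftrightarrow> homogeneous 2 f \<and> rank (gram_matrix f) = CARD('n)"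
| "persistent (Suc (Suc (Suc n))) f \<longleftrightarrow>
     homogeneous (Suc (Suc (Suc n))) f \<and> concise f \<and>
     (\<exists>S :: (complex ^ 'n) set. hyperplane S \<and>
        (\<forall>u. u \<notin> S \<longrightarrow> persistent (Suc (Suc n)) (dir_partial u f)))"

end

theory Submission
  imports Defs "HOL-Computational_Algebra.Fundamental_Theorem_Algebra"
begin

text \<open>
  For a cubic \<open>f\<close> the second derivatives are linear forms, so the Hessian matrix \<open>H(u)\<close>, evaluated at
  a point \<open>u\<close>, depends linearly on \<open>u\<close>. By symmetry of the third derivatives \<open>H(u)\<close> is also the
  (constant) Hessian matrix of the quadratic form \<open>\<partial>f/\<partial>u\<close>, that is, twice its Gram matrix
  (\<open>gram_matrix_dir_partial\<close>). Hence \<open>\<partial>f/\<partial>u\<close> is nonsingular exactly if \<open>det H(u) = Hess f (u)\<close> does not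
  vanish, and \<open>f\<close> is persistent iff it is concise and \<open>Hess f\<close> has no zero outside some hyperplane
  \<open>S\<close> (\<open>persistent_cubic_iff\<close>).

  If \<open>Hess f = l\<^sup>d\<close>, the kernel of \<open>l\<close> is such a hyperplane. Moreover a linear relation between the
  partial derivatives of \<open>f\<close> lies in the kernel of every \<open>H(u)\<close>, so one nonzero value of \<open>Hess f\<close>
  already forces \<open>f\<close> to be concise.

  Conversely, let \<open>v \<notin> S\<close>, and let \<open>a\<close> be the linear functional with kernel \<open>S\<close> and \<open>a(v) = 1\<close>. Each
  point has the form \<open>w + t v\<close> with \<open>w \<in> S\<close> and \<open>t\<close> the value of \<open>a\<close>, and
  \<open>det H(w + t v) = det (H(w) + t H(v))\<close> vanishes at most for \<open>t = 0\<close>. A polynomial in one variable over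
  the complex numbers with this property is a multiple of a power of \<open>t\<close>; here this gives
  \<open>det H(w + t v) = t\<^sup>d det H(v)\<close> (\<open>det_pencil_power\<close>). So \<open>Hess f\<close> and \<open>det H(v) a\<^sup>d\<close> agree as
  functions, hence as polynomials (\<open>cpoly_eqI_evaluate\<close>), and a \<open>d\<close>-th root of \<open>det H(v)\<close> can be
  absorbed into the linear form.
\<close>

section \<open>Polynomials as functions\<close>

definition monom_val :: "complex ^ 'n \<Rightarrow> ('n::finite \<Rightarrow>\<^sub>0 nat) \<Rightarrow> complex" where
  "monom_val x m = (\<Prod>i\<in>UNIV. x $ i ^ Poly_Mapping.lookup m i)"

definition evaluate :: "complex ^ 'n \<Rightarrow> 'n::finite cpoly \<Rightarrow> complex" where
  "evaluate x p = (\<Sum>m\<in>Poly_Mapping.keys p. Poly_Mapping.lookup p m * monom_val x m)"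

lemma monom_val_zero [simp]: "monom_val x 0 = 1"
  by (simp add: monom_val_def)

lemma monom_val_add: "monom_val x (m + k) = monom_val x m * monom_val x k"
  by (simp add: monom_val_def lookup_add power_add prod.distrib)

lemma evaluate_superset:
  assumes "finite A" "Poly_Mapping.keys p \<subseteq> A"
  shows "evaluate x p = (\<Sum>m\<in>A. Poly_Mapping.lookup p m * monom_val x m)"
  unfolding evaluate_def
  using assms by (intro sum.mono_neutral_left) (auto simp: in_keys_iff)

lemma evaluate_zero [simp]: "evaluate x 0 = 0"
  by (simp add: evaluate_def)

lemma evaluate_add: "evaluate x (p + q) = evaluate x p + evaluate x q"
proof -
  let ?A = "Poly_Mapping.keys p \<union> Poly_Mapping.keys q"
  show ?thesis
    using evaluate_superset[of ?A "p + q" x] evaluate_superset[of ?A p x]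
      evaluate_superset[of ?A q x] keys_add[of p q]
    by (simp add: lookup_add distrib_right sum.distrib)
qed

lemma evaluate_sum: "evaluate x (sum g A) = (\<Sum>a\<in>A. evaluate x (g a))"
  by (induction A rule: infinite_finite_induct) (simp_all add: evaluate_add)

lemma evaluate_single: "evaluate x (Poly_Mapping.single m c) = c * monom_val x m"
  by (simp add: evaluate_def)

lemma sum_of_terms:
  "p = (\<Sum>m\<in>Poly_Mapping.keys p. Poly_Mapping.single m (Poly_Mapping.lookup p m))"
  by (rule poly_mapping_eqI) (simp add: lookup_sum lookup_single when_def in_keys_iff)

lemma evaluate_mult: "evaluate x (p * q) = evaluate x p * evaluate x q"
proof -
  have "p * q = (\<Sum>m\<in>Poly_Mapping.keys p. \<Sum>k\<in>Poly_Mapping.keys q.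
      Poly_Mapping.single (m + k) (Poly_Mapping.lookup p m * Poly_Mapping.lookup q k))"
    by (subst sum_of_terms[of p], subst sum_of_terms[of q])
       (simp add: sum_product mult_single)
  then show ?thesis
    by (simp add: evaluate_sum evaluate_single monom_val_add evaluate_def[of x p]
        evaluate_def[of x q] sum_product mult_ac)
qed

lemma evaluate_one [simp]: "evaluate x 1 = 1"
  using evaluate_single[of x 0 1] by simp

lemma evaluate_power: "evaluate x (p ^ n) = evaluate x p ^ n"
  by (induction n) (simp_all add: evaluate_mult)

lemma evaluate_prod: "evaluate x (prod g A) = (\<Prod>a\<in>A. evaluate x (g a))"
  by (induction A rule: infinite_finite_induct) (simp_all add: evaluate_mult)

lemma evaluate_of_int: "evaluate x (of_int k) = of_int k"
  by (metis evaluate_single monom_val_zero mult.right_neutral single_of_int)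

text \<open>Evaluation is a ring homomorphism and therefore commutes with determinants: the Hessian
  can be studied through the complex matrices obtained at each point.\<close>

lemma evaluate_det: "evaluate x (det A) = det (\<chi> i j. evaluate x (A $ i $ j))"
  by (simp add: det_def evaluate_sum evaluate_mult evaluate_prod evaluate_of_int)

lemma two_power_inject_complex: "(2::complex) ^ m = 2 ^ n \<longleftrightarrow> m = n"
proof
  assume "(2::complex) ^ m = 2 ^ n"
  then have "norm ((2::complex) ^ m) = norm ((2::complex) ^ n)" by simp
  then show "m = n" by (simp add: norm_power)
qed simp

lemma monomials_separate_points:
  assumes "m \<noteq> k"
  obtains y where "monom_val y m \<noteq> monom_val y k"
proof -
  obtain i where i: "Poly_Mapping.lookup m i \<noteq> Poly_Mapping.lookup k i"
    using assms poly_mapping_eqI by metis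
  have "monom_val (\<chi> j. if j = i then 2 else 1) n = 2 ^ Poly_Mapping.lookup n i" for n
  proof -
    have "monom_val (\<chi> j. if j = i then 2 else 1) n
        = (\<Prod>j\<in>UNIV. if j = i then 2 ^ Poly_Mapping.lookup n j else 1)"
      unfolding monom_val_def by (intro prod.cong) auto
    then show ?thesis by simp
  qed
  moreover have "(2::complex) ^ Poly_Mapping.lookup m i \<noteq> 2 ^ Poly_Mapping.lookup k i"
    using i by (simp add: two_power_inject_complex)
  ultimately show ?thesis using that by metis
qed

text \<open>Artin's argument for the independence of characters: a monomial is a multiplicative function of
  the point. Replacing \<open>x\<close> by \<open>y x\<close> (componentwise) in a relation and subtracting \<open>y\<^sup>k\<close> times the
  original relation eliminates the monomial \<open>k\<close>, and keeps the coefficient of \<open>m\<close> up to a factor that is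
  nonzero if \<open>y\<close> separates \<open>m\<close> from \<open>k\<close>.\<close>

lemma monomials_independent:
  assumes "finite F" "\<And>x. (\<Sum>m\<in>F. c m * monom_val x m) = 0"
  shows "\<forall>m\<in>F. c m = 0"
  using assms
proof (induction F arbitrary: c rule: finite_induct)
  case (insert k F)
  have F0: "c m = 0" if "m \<in> F" for m
  proof -
    obtain y where y: "monom_val y m \<noteq> monom_val y k"
      using monomials_separate_points \<open>m \<in> F\<close> \<open>k \<notin> F\<close> by metis
    have "(\<Sum>m\<in>F. (c m * (monom_val y m - monom_val y k)) * monom_val x m) = 0" for x
    proof -
      have mult: "monom_val (\<chi> i. y $ i * x $ i) m = monom_val y m * monom_val x m" for m
        by (simp add: monom_val_def power_mult_distrib prod.distrib)
      have "c k * (monom_val y k * monom_val x k)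
          + (\<Sum>m\<in>F. c m * (monom_val y m * monom_val x m)) = 0"
        using insert.prems[of "\<chi> i. y $ i * x $ i"] insert.hyps by (simp add: mult)
      moreover have "c k * monom_val x k + (\<Sum>m\<in>F. c m * monom_val x m) = 0"
        using insert.prems[of x] insert.hyps by simp
      moreover have "(\<Sum>m\<in>F. (c m * (monom_val y m - monom_val y k)) * monom_val x m)
          = (\<Sum>m\<in>F. c m * (monom_val y m * monom_val x m))
            - monom_val y k * (\<Sum>m\<in>F. c m * monom_val x m)"
        unfolding sum_distrib_left sum_subtractf[symmetric]
        by (intro sum.cong refl) (simp add: algebra_simps)
      ultimately show ?thesis by algebra
    qed
    from insert.IH[OF this] that y show ?thesis by auto
  qed
  moreover have "c k = 0"
    using insert.prems[of 1] insert.hyps F0 by (simp add: monom_val_def)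
  ultimately show ?case by simp
qed simp

lemma cpoly_eqI_evaluate:
  assumes "\<And>x. evaluate x p = evaluate x q"
  shows "p = q"
proof (rule poly_mapping_eqI)
  fix m
  define F where "F = insert m (Poly_Mapping.keys p \<union> Poly_Mapping.keys q)"
  have F: "finite F" "Poly_Mapping.keys p \<subseteq> F" "Poly_Mapping.keys q \<subseteq> F" "m \<in> F"
    by (auto simp: F_def)
  have "(\<Sum>m\<in>F. (Poly_Mapping.lookup p m - Poly_Mapping.lookup q m) * monom_val x m) = 0" for x
    using assms[of x]
    unfolding evaluate_superset[OF F(1,2)] evaluate_superset[OF F(1,3)]
    by (simp add: left_diff_distrib sum_subtractf)
  from monomials_independent[OF F(1) this] F(4)
  have "Poly_Mapping.lookup p m - Poly_Mapping.lookup q m = 0" by blast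
  then show "Poly_Mapping.lookup p m = Poly_Mapping.lookup q m" by simp
qed

section \<open>Derivatives and linear forms\<close>

lemma lookup_Const_mult: "Poly_Mapping.lookup (Const c * p) m = c * Poly_Mapping.lookup p m"
proof -
  have "Const c * p = Poly_Mapping.map ((*) c) p"
    by (simp only: Const_def mult_map_scale_conv_mult)
  then show ?thesis
    by (simp add: Poly_Mapping.map.rep_eq when_def)
qed

lemma evaluate_Const [simp]: "evaluate x (Const c) = c"
  by (simp add: Const_def evaluate_single)

lemma lookup_partial:
  "Poly_Mapping.lookup (partial i p) m
     = of_nat (Poly_Mapping.lookup m i + 1) * Poly_Mapping.lookup p (m + Poly_Mapping.single i 1)"
proof -
  let ?e = "Poly_Mapping.single i (1::nat)"
  let ?t = "\<lambda>k. of_nat (Poly_Mapping.lookup k i) * Poly_Mapping.lookup p k"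
  \<comment> \<open>Truncated subtraction of exponents is invertible on the monomials that contain \<open>x\<^sub>i\<close>; all others
    contribute zero.\<close>
  have shift: "k - ?e = m \<longleftrightarrow> k = m + ?e" if "Poly_Mapping.lookup k i \<noteq> 0" for k
  proof -
    have "k - ?e + ?e = k"
      using that by (intro poly_mapping_eqI) (auto simp: lookup_add lookup_minus lookup_single when_def)
    then show ?thesis by (metis add_diff_cancel_right')
  qed
  have "Poly_Mapping.lookup (partial i p) m = (\<Sum>k\<in>Poly_Mapping.keys p. ?t k when k - ?e = m)"
    by (simp add: partial_def lookup_sum lookup_single)
  also have "\<dots> = (\<Sum>k\<in>Poly_Mapping.keys p. if k = m + ?e then ?t k else 0)"
    using shift by (intro sum.cong refl) (auto simp: when_def)
  also have "\<dots> = ?t (m + ?e)"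
    by (simp add: in_keys_iff)
  finally show ?thesis by (simp add: lookup_add)
qed

lemma homogeneous_iff_lookup:
  "homogeneous n p \<longleftrightarrow>
     (\<forall>m. Poly_Mapping.lookup p m \<noteq> 0 \<longrightarrow> (\<Sum>i\<in>UNIV. Poly_Mapping.lookup m i) = n)"
  by (auto simp: homogeneous_def in_keys_iff)

lemma homogeneous_partial:
  assumes "homogeneous (Suc n) p"
  shows "homogeneous n (partial i p)"
  using assms
  by (auto simp: homogeneous_iff_lookup lookup_partial lookup_add sum.distrib lookup_single
      when_def simp del: of_nat_Suc of_nat_add)

lemma lookup_dir_partial:
  "Poly_Mapping.lookup (dir_partial u p) m = (\<Sum>k\<in>UNIV. u $ k * Poly_Mapping.lookup (partial k p) m)"
  by (simp add: dir_partial_def lookup_sum lookup_Const_mult)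

lemma homogeneous_dir_partial:
  assumes "homogeneous (Suc n) p"
  shows "homogeneous n (dir_partial u p)"
  unfolding homogeneous_iff_lookup
proof (intro allI impI)
  fix m assume "Poly_Mapping.lookup (dir_partial u p) m \<noteq> 0"
  then obtain k where "Poly_Mapping.lookup (partial k p) m \<noteq> 0"
    unfolding lookup_dir_partial by (metis (no_types, lifting) mult_zero_right sum.neutral)
  then show "(\<Sum>i\<in>UNIV. Poly_Mapping.lookup m i) = n"
    using homogeneous_partial[OF assms] by (auto simp: homogeneous_iff_lookup)
qed

lemma partial_commute: "partial i (partial j p) = partial j (partial i p)"
  by (rule poly_mapping_eqI)
     (auto simp: lookup_partial lookup_add lookup_single when_def add_ac)

lemma degree_one_monomial:
  fixes m :: "'n::finite \<Rightarrow>\<^sub>0 nat"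
  assumes "(\<Sum>i\<in>UNIV. Poly_Mapping.lookup m i) = 1"
  obtains k where "m = Poly_Mapping.single k 1"
proof -
  obtain k where k: "Poly_Mapping.lookup m k = 1" "\<forall>j. j \<noteq> k \<longrightarrow> Poly_Mapping.lookup m j = 0"
    using assms sum_eq_1_iff[of UNIV "Poly_Mapping.lookup m"] by force
  then have "m = Poly_Mapping.single k 1"
    by (auto intro!: poly_mapping_eqI simp: lookup_single when_def)
  then show ?thesis using that by blast
qed

definition linear_form :: "complex ^ 'n \<Rightarrow> 'n::finite cpoly" where
  "linear_form a = (\<Sum>k\<in>UNIV. Poly_Mapping.single (Poly_Mapping.single k 1) (a $ k))"

lemma single_one_inject:
  "Poly_Mapping.single i (1::nat) = Poly_Mapping.single j 1 \<longleftrightarrow> i = j"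
  by (metis lookup_single_eq lookup_single_not_eq zero_neq_one)

lemma lookup_linear_form:
  "Poly_Mapping.lookup (linear_form a) (Poly_Mapping.single k 1) = a $ k"
  unfolding linear_form_def
  by (simp add: lookup_sum lookup_single when_def single_one_inject[unfolded One_nat_def])

lemma evaluate_linear_form: "evaluate u (linear_form a) = (\<Sum>k\<in>UNIV. a $ k * u $ k)"
proof -
  have "monom_val u (Poly_Mapping.single k 1) = u $ k" for k
  proof -
    have "monom_val u (Poly_Mapping.single k 1) = (\<Prod>j\<in>UNIV. if j = k then u $ j else 1)"
      unfolding monom_val_def by (intro prod.cong) (auto simp: lookup_single when_def)
    then show ?thesis by simp
  qed
  then show ?thesis
    by (simp add: linear_form_def evaluate_sum evaluate_single)
qed

lemma homogeneous_linear_form: "homogeneous 1 (linear_form a)"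
  unfolding homogeneous_iff_lookup
proof (intro allI impI)
  fix m assume "Poly_Mapping.lookup (linear_form a) m \<noteq> 0"
  then have "\<exists>k. m = Poly_Mapping.single k 1"
    unfolding linear_form_def lookup_sum lookup_single
    by (rule contrapos_np) (auto simp: when_def intro!: sum.neutral)
  then obtain k where "m = Poly_Mapping.single k 1" by blast
  then show "(\<Sum>i\<in>UNIV. Poly_Mapping.lookup m i) = 1"
    by (simp add: lookup_single when_def)
qed

lemma homogeneous_1_eq_linear_form:
  assumes "homogeneous 1 p"
  shows "p = linear_form (\<chi> k. Poly_Mapping.lookup p (Poly_Mapping.single k 1))"
    (is "p = ?l")
proof (rule poly_mapping_eqI)
  fix m
  show "Poly_Mapping.lookup p m = Poly_Mapping.lookup ?l m"
  proof (cases "(\<Sum>i\<in>UNIV. Poly_Mapping.lookup m i) = 1")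
    case True
    then obtain k where m: "m = Poly_Mapping.single k 1"
      by (rule degree_one_monomial)
    show ?thesis unfolding m lookup_linear_form by simp
  next
    case False
    then show ?thesis
      using assms homogeneous_linear_form[of "\<chi> k. Poly_Mapping.lookup p (Poly_Mapping.single k 1)"]
      unfolding homogeneous_iff_lookup by metis
  qed
qed

section \<open>The Hessian matrix of a cubic\<close>

definition hessian_at :: "'n::finite cpoly \<Rightarrow> complex ^ 'n \<Rightarrow> complex ^ 'n ^ 'n" where
  "hessian_at f u = (\<chi> i j. evaluate u (partial i (partial j f)))"

lemma evaluate_Hess: "evaluate u (Hess f) = det (hessian_at f u)"
  by (simp add: Hess_def hessian_at_def evaluate_det)

lemma hessian_at_cubic:
  assumes "homogeneous 3 f"
  shows "hessian_at f u $ i $ j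
     = (\<Sum>k\<in>UNIV. u $ k * Poly_Mapping.lookup (partial k (partial i (partial j f))) 0)"
proof -
  have "homogeneous 1 (partial i (partial j f))"
    using assms by (intro homogeneous_partial) (simp add: numeral_eq_Suc)
  from homogeneous_1_eq_linear_form[OF this]
  have "evaluate u (partial i (partial j f)) = (\<Sum>k\<in>UNIV.
      Poly_Mapping.lookup (partial i (partial j f)) (Poly_Mapping.single k 1) * u $ k)"
    by (metis (no_types, lifting) evaluate_linear_form sum.cong vec_lambda_beta)
  then show ?thesis
    by (simp add: hessian_at_def lookup_partial[of _ "partial i (partial j f)"] mult.commute)
qed

lemma hessian_at_affine:
  assumes "homogeneous 3 f"
  shows "hessian_at f (x + t *s y) = (\<chi> i j. hessian_at f x $ i $ j + t * hessian_at f y $ i $ j)"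
  by (simp add: vec_eq_iff hessian_at_cubic[OF assms] sum_distrib_left sum.distrib distrib_right
      mult_ac)

text \<open>Both sides read off the third derivatives of \<open>f\<close>: on the right \<open>u\<close> is the point where the linear
  form \<open>\<partial>\<^sub>i\<partial>\<^sub>jf\<close> is evaluated, on the left it is the direction of the third derivative. The factor is
  that between a quadratic form and its second derivatives.\<close>

lemma gram_matrix_dir_partial:
  assumes "homogeneous 3 f"
  shows "gram_matrix (dir_partial u f) = (\<chi> i. (1/2) *s hessian_at f u $ i)"
proof -
  have "gram_matrix (dir_partial u f) $ i $ j = hessian_at f u $ i $ j / 2" for i j
  proof -
    have "gram_matrix q $ i $ j = Poly_Mapping.lookup (partial i (partial j q)) 0 / 2" for q
      by (simp add: gram_matrix_def lookup_partial lookup_add lookup_single when_def)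
    moreover have "Poly_Mapping.lookup (partial i (partial j (dir_partial u f))) 0
        = (\<Sum>k\<in>UNIV. u $ k * Poly_Mapping.lookup (partial i (partial j (partial k f))) 0)"
      by (simp add: lookup_partial[of i] lookup_partial[of j] lookup_dir_partial
          sum_distrib_left mult_ac)
    ultimately show ?thesis
      unfolding hessian_at_cubic[OF assms]
      by (simp add: partial_commute[of _ k for k] partial_commute)
  qed
  then show ?thesis by (simp add: vec_eq_iff)
qed

lemma rank_eq_card_iff_det:
  fixes A :: "'a::field ^ 'n ^ 'n"
  shows "rank A = CARD('n) \<longleftrightarrow> det A \<noteq> 0"
proof -
  have "rank A = CARD('n) \<longleftrightarrow> vec.span (rows A) = UNIV"
    unfolding row_rank_def_gen
    using vec.dim_eq_full[of "rows A"] by (simp add: vec.dimension_def card_cart_basis)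
  then show ?thesis
    by (simp add: matrix_left_invertible_span_rows_gen[symmetric] invertible_left_inverse[symmetric]
        invertible_det_nz)
qed

lemma det_scale:
  fixes A :: "'a::comm_ring_1 ^ 'n ^ 'n"
  shows "det (\<chi> i. c *s A $ i) = c ^ CARD('n) * det A"
  using det_rows_mul[of "\<lambda>_. c" "\<lambda>i. A $ i"] by simp

lemma persistent_dir_partial_iff:
  fixes f :: "'n::finite cpoly"
  assumes "homogeneous 3 f"
  shows "persistent 2 (dir_partial u f) \<longleftrightarrow> det (hessian_at f u) \<noteq> 0"
proof -
  have "homogeneous 2 (dir_partial u f)"
    using assms by (intro homogeneous_dir_partial) (simp add: numeral_eq_Suc)
  then show ?thesis
    by (simp add: numeral_2_eq_2 rank_eq_card_iff_det
        gram_matrix_dir_partial[OF assms] det_scale)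
qed

lemma persistent_cubic_iff:
  fixes f :: "'n::finite cpoly"
  assumes "homogeneous 3 f"
  shows "persistent 3 f \<longleftrightarrow> concise f \<and>
     (\<exists>S. hyperplane S \<and> (\<forall>u. u \<notin> S \<longrightarrow> det (hessian_at f u) \<noteq> 0))"
  using assms
  by (simp add: numeral_3_eq_3 persistent_dir_partial_iff[unfolded numeral_2_eq_2 numeral_3_eq_3]
      del: persistent.simps(3))

text \<open>Differentiating a relation \<open>\<Sum>\<^sub>j c\<^sub>j \<partial>\<^sub>jf = 0\<close> once more shows that \<open>c\<close> is in the kernel of the
  Hessian matrix at every point.\<close>

lemma concise_if_det_hessian_nonzero:
  fixes f :: "'n::finite cpoly"
  assumes "det (hessian_at f u) \<noteq> 0"
  shows "concise f"
  unfolding concise_def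
proof (intro allI impI)
  fix c :: "'n \<Rightarrow> complex" and k
  assume 0: "(\<Sum>i\<in>UNIV. Const (c i) * partial i f) = 0"
  have "hessian_at f u *v (\<chi> j. c j) = 0"
  proof -
    have "(\<Sum>j\<in>UNIV. Const (c j) * partial i (partial j f)) = 0" for i
    proof (rule poly_mapping_eqI)
      fix m
      have "(\<Sum>j\<in>UNIV. c j * Poly_Mapping.lookup (partial j f) (m + Poly_Mapping.single i 1)) = 0"
        using arg_cong[OF 0, of "\<lambda>p. Poly_Mapping.lookup p (m + Poly_Mapping.single i 1)"]
        by (simp add: lookup_sum lookup_Const_mult)
      then have "(1 + of_nat (Poly_Mapping.lookup m i)) *
          (\<Sum>j\<in>UNIV. c j * Poly_Mapping.lookup (partial j f) (m + Poly_Mapping.single i 1)) = 0"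
        by simp
      then show "Poly_Mapping.lookup (\<Sum>j\<in>UNIV. Const (c j) * partial i (partial j f)) m
          = Poly_Mapping.lookup 0 m"
        by (simp add: lookup_sum lookup_Const_mult lookup_partial[of i] sum_distrib_left mult_ac)
    qed
    from arg_cong[OF this, of "evaluate u"] show ?thesis
      by (simp add: vec_eq_iff matrix_vector_mult_def hessian_at_def evaluate_sum evaluate_mult
          mult.commute)
  qed
  then have "(\<chi> j. c j) = 0"
    using assms
    by (metis invertible_det_nz invertible_left_inverse matrix_left_invertible_ker)
  then show "c k = 0" by (simp add: vec_eq_iff)
qed

section \<open>Hyperplanes\<close>

lemma hyperplane_kernel:
  fixes a :: "complex ^ 'n::finite"
  assumes "a \<noteq> 0"
  shows "hyperplane {u. (\<Sum>k\<in>UNIV. a $ k * u $ k) = 0}" (is "hyperplane ?S")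
proof -
  let ?l = "\<lambda>u. \<Sum>k\<in>UNIV. a $ k * u $ k"
  have sub: "vec.subspace ?S"
    by (auto simp: vec.subspace_def distrib_left sum.distrib sum_distrib_left[symmetric]
        mult.left_commute)
  obtain k where k: "a $ k \<noteq> 0" using assms by (auto simp: vec_eq_iff)
  define v where "v = axis k (1::complex)"
  have lv: "?l v = a $ k" by (simp add: v_def axis_def if_distrib cong: if_cong)
  have "v \<notin> vec.span ?S" using k lv by (simp add: vec.span_eq_iff[THEN iffD2, OF sub])
  moreover have "vec.span (insert v ?S) = UNIV"
  proof -
    have "u - (?l u / a $ k) *s v \<in> vec.span ?S" for u
    proof (rule vec.span_base)
      have "?l (u - (?l u / a $ k) *s v) = ?l u - (?l u / a $ k) * ?l v"
        by (simp add: right_diff_distrib sum_subtractf sum_distrib_left mult.left_commute)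
      then show "u - (?l u / a $ k) *s v \<in> ?S" using k lv by simp
    qed
    then show ?thesis unfolding vec.span_breakdown_eq set_eq_iff by blast
  qed
  then have "vec.dim (insert v ?S) = CARD('n)"
    using vec.dim_eq_full[of "insert v ?S"] by (simp add: vec.dimension_def card_cart_basis)
  ultimately have "vec.dim ?S + 1 = CARD('n)" by (simp add: vec.dim_insert)
  with sub show ?thesis by (simp add: hyperplane_def)
qed

text \<open>A hyperplane and a point outside it determine a coordinate: the functional \<open>a\<close> that vanishes on
  \<open>S\<close> and is \<open>1\<close> at \<open>v\<close>. The last property says that projecting along \<open>v\<close> to the level zero of this
  coordinate ends up in \<open>S\<close>.\<close>

lemma hyperplane_coordinate:
  fixes S :: "(complex ^ 'n::finite) set"
  assumes "hyperplane S"
  obtains a v :: "complex ^ 'n" where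
    "v \<notin> S" "a \<noteq> 0" "\<And>u. u - (\<Sum>k\<in>UNIV. a $ k * u $ k) *s v \<in> S"
proof -
  have sub: "vec.subspace S" and dim: "vec.dim S + 1 = CARD('n)"
    using assms by (auto simp: hyperplane_def)
  have span: "vec.span S = S" using sub by (simp add: vec.span_eq_iff)
  have "S \<noteq> UNIV"
  proof
    assume "S = UNIV"
    then show False using dim vec.dim_eq_full[of S] span
      by (simp add: vec.dimension_def card_cart_basis)
  qed
  then obtain v where v: "v \<notin> S" by auto
  have "vec.dim (insert v S) = CARD('n)"
    using v dim by (simp add: vec.dim_insert span)
  then have "vec.span (insert v S) = UNIV"
    using vec.dim_eq_full[of "insert v S"] by (simp add: vec.dimension_def card_cart_basis)
  \<comment> \<open>It suffices to fix the coordinate of each basis vector; linearity does the rest.\<close>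
  then have "\<forall>k. \<exists>c. axis k 1 - c *s v \<in> S"
    using vec.span_breakdown_eq[of _ v S] span by auto
  then obtain c where c: "\<And>k. axis k 1 - c k *s v \<in> S" by metis
  define a where "a = (\<chi> k. c k)"
  have mem: "u - (\<Sum>k\<in>UNIV. a $ k * u $ k) *s v \<in> S" for u
  proof -
    have "(\<Sum>k\<in>UNIV. u $ k *s (axis k 1 - c k *s v)) \<in> S"
      using c by (intro vec.subspace_sum[OF sub] vec.subspace_scale[OF sub]) auto
    moreover have "(\<Sum>k\<in>UNIV. u $ k *s (axis k 1 - c k *s v))
        = (\<Sum>k\<in>UNIV. u $ k *s axis k 1) - (\<Sum>k\<in>UNIV. a $ k * u $ k) *s v"
      by (simp add: vec.scale_right_diff_distrib sum_subtractf vec.scale_sum_left a_def mult.commute)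
    ultimately show ?thesis by (simp add: basis_expansion)
  qed
  have "a \<noteq> 0" using mem[of v] v by auto
  with v mem show ?thesis using that by blast
qed

section \<open>Pencils of matrices\<close>

text \<open>The determinant is a polynomial in \<open>t\<close>, and a complex polynomial without zeros is constant.\<close>

lemma det_pencil_constant:
  fixes A B :: "complex ^ 'n ^ 'n"
  assumes "\<And>t. det (\<chi> i j. A $ i $ j + t * B $ i $ j) \<noteq> 0"
  shows "det (\<chi> i j. A $ i $ j + t * B $ i $ j) = det A"
proof -
  define p where "p = det (\<chi> i j. [:A $ i $ j, B $ i $ j:])"
  have p: "poly p t = det (\<chi> i j. A $ i $ j + t * B $ i $ j)" for t
    by (simp add: p_def det_def poly_sum poly_prod)
  have "constant (poly p)"
    using fundamental_theorem_of_algebra[of p] assms p by auto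
  then have "poly p t = poly p 0" by (simp add: constant_def)
  then show ?thesis by (simp add: p)
qed

text \<open>Passing to the reciprocal parameter turns \<open>A + t B\<close> into \<open>B + s A\<close>. The determinant of the latter has
  no zero at all, the value \<open>s = 0\<close> being covered by the invertibility of \<open>B\<close>, so it is constant.\<close>

lemma det_pencil_power:
  fixes A B :: "complex ^ 'n ^ 'n"
  assumes "\<And>t. t \<noteq> 0 \<Longrightarrow> det (\<chi> i j. A $ i $ j + t * B $ i $ j) \<noteq> 0" and "det B \<noteq> 0"
  shows "det (\<chi> i j. A $ i $ j + t * B $ i $ j) = t ^ CARD('n) * det B"
proof -
  have rescale: "det (\<chi> i j. A $ i $ j + t * B $ i $ j)
      = t ^ CARD('n) * det (\<chi> i j. B $ i $ j + inverse t * A $ i $ j)" if "t \<noteq> 0" for t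
  proof -
    have "(\<chi> i j. A $ i $ j + t * B $ i $ j)
        = (\<chi> i. t *s (\<chi> i j. B $ i $ j + inverse t * A $ i $ j) $ i)"
      using that by (simp add: vec_eq_iff field_simps)
    then show ?thesis by (simp only: det_scale)
  qed
  have "det (\<chi> i j. B $ i $ j + s * A $ i $ j) \<noteq> 0" for s
  proof (cases "s = 0")
    case False
    then show ?thesis using assms(1)[of "inverse s"] rescale[of "inverse s"] by auto
  qed (use assms(2) in simp)
  then have nonzero: "det (\<chi> i j. A $ i $ j + t * B $ i $ j) = t ^ CARD('n) * det B" if "t \<noteq> 0" for t
    using rescale[OF that] det_pencil_constant[of B A] by simp
  show ?thesis
  proof (cases "t = 0")
    case True
    \<comment> \<open>Otherwise \<open>A + t B\<close> has constant determinant too, but \<open>t\<^sup>d\<close> takes different values at \<open>1\<close> and \<open>2\<close>.\<close>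
    have "det A = 0"
    proof (rule ccontr)
      assume "det A \<noteq> 0"
      then have "det (\<chi> i j. A $ i $ j + t * B $ i $ j) \<noteq> 0" for t
        using assms(1) by (cases "t = 0") auto
      from det_pencil_constant[of A B 1, OF this] det_pencil_constant[of A B 2, OF this]
      have "(2::complex) ^ CARD('n) = 1"
        using nonzero[of 1] nonzero[of 2] assms(2) by simp
      then show False using two_power_inject_complex[of "CARD('n)" 0] by simp
    qed
    with True show ?thesis by simp
  qed (rule nonzero)
qed

section \<open>Cubics whose Hessian is a power of a linear form\<close>

text \<open>On the line through \<open>w = u - t v\<close> in direction \<open>v\<close> the Hessian matrix is a pencil, and the only point
  of that line in \<open>S\<close> is \<open>w\<close>.\<close>

lemma det_hessian_eq_power:
  fixes f :: "'n::finite cpoly"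
  assumes f: "homogeneous 3 f" and S: "vec.subspace S"
    and nz: "\<And>u. u \<notin> S \<Longrightarrow> det (hessian_at f u) \<noteq> 0"
    and v: "v \<notin> S" and u: "u - t *s v \<in> S"
  shows "det (hessian_at f u) = t ^ CARD('n) * det (hessian_at f v)"
proof -
  let ?w = "u - t *s v"
  have "det (\<chi> i j. hessian_at f ?w $ i $ j + s * hessian_at f v $ i $ j) \<noteq> 0" if "s \<noteq> 0" for s
  proof -
    have "?w + s *s v \<notin> S"
    proof
      assume "?w + s *s v \<in> S"
      then have "s *s v \<in> S" using vec.subspace_diff[OF S _ u] by fastforce
      from vec.subspace_scale[OF S this, of "inverse s"] show False
        using that v by simp
    qed
    from nz[OF this] show ?thesis by (simp add: hessian_at_affine[OF f])
  qed
  from det_pencil_power[OF this nz[OF v], of t]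
  show ?thesis by (simp add: hessian_at_affine[OF f, symmetric])
qed

theorem corollary4:
  fixes f :: "'n::finite cpoly"
  assumes "homogeneous 3 f"
  shows "(\<exists>l :: 'n cpoly. l \<noteq> 0 \<and> homogeneous 1 l \<and> Hess f = l ^ CARD('n))
           \<longleftrightarrow> persistent 3 f"
proof
  assume "\<exists>l :: 'n cpoly. l \<noteq> 0 \<and> homogeneous 1 l \<and> Hess f = l ^ CARD('n)"
  then obtain l :: "'n cpoly" where l: "l \<noteq> 0" "homogeneous 1 l" "Hess f = l ^ CARD('n)"
    by blast
  then obtain a where a: "l = linear_form a"
    using homogeneous_1_eq_linear_form by blast
  have "a \<noteq> 0" using l(1) a by (auto simp: linear_form_def)
  define S where "S = {u. (\<Sum>k\<in>UNIV. a $ k * u $ k) = 0}"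
  have "hyperplane S" unfolding S_def by (rule hyperplane_kernel[OF \<open>a \<noteq> 0\<close>])
  moreover have nz: "det (hessian_at f u) \<noteq> 0" if "u \<notin> S" for u
    using that by (simp add: evaluate_Hess[symmetric] l(3) evaluate_power a evaluate_linear_form S_def)
  moreover have "concise f"
    using hyperplane_coordinate[OF \<open>hyperplane S\<close>] nz concise_if_det_hessian_nonzero by metis
  ultimately show "persistent 3 f"
    using persistent_cubic_iff[OF assms] by blast
next
  assume "persistent 3 f"
  then obtain S where S: "hyperplane S" and nz: "\<And>u. u \<notin> S \<Longrightarrow> det (hessian_at f u) \<noteq> 0"
    using persistent_cubic_iff[OF assms] by blast
  obtain a v where v: "v \<notin> S" and "a \<noteq> 0"
    and mem: "\<And>u. u - (\<Sum>k\<in>UNIV. a $ k * u $ k) *s v \<in> S"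
    using hyperplane_coordinate[OF S] by metis
  obtain r where r: "det (hessian_at f v) = r ^ CARD('n)"
    using exists_complex_root[of "CARD('n)"] by auto
  have "r \<noteq> 0" using r nz[OF v] by auto
  let ?l = "linear_form (r *s a)"
  have "Hess f = ?l ^ CARD('n)"
  proof (rule cpoly_eqI_evaluate)
    fix u
    have "evaluate u (Hess f) = (\<Sum>k\<in>UNIV. a $ k * u $ k) ^ CARD('n) * r ^ CARD('n)"
      using det_hessian_eq_power[OF assms _ nz v mem] S r
      by (simp add: evaluate_Hess hyperplane_def)
    then show "evaluate u (Hess f) = evaluate u (?l ^ CARD('n))"
      by (simp add: evaluate_power evaluate_linear_form power_mult_distrib[symmetric]
          sum_distrib_left sum_distrib_right mult_ac)
  qed
  moreover have "?l \<noteq> 0"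
  proof
    assume "?l = 0"
    then have "r *s a = 0"
      using lookup_linear_form[of "r *s a"] by (simp add: vec_eq_iff)
    with \<open>r \<noteq> 0\<close> \<open>a \<noteq> 0\<close> show False by simp
  qed
  ultimately show "\<exists>l :: 'n cpoly. l \<noteq> 0 \<and> homogeneous 1 l \<and> Hess f = l ^ CARD('n)"
    using homogeneous_linear_form by blast
qed

end
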